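(* If $p,q,r>1$ satisfy $\frac1p+\frac1q=1+\frac1r$, then for any $f\in L_p(\mathbb{R})$ and $g\in L_q(\mathbb{R})$ the convolution $f\underset{H}{*}g$ belongs to $L_r(\mathbb{R})$, and $$\big\|f \underset{H}{*} g\big\|_{L_r(\mathbb{R})} \leq \sqrt{\frac{2}{\pi}}\,\|f\|_{L_p(\mathbb{R})} \|g\|_{L_q(\mathbb{R})}.$$
   Context: The Hartley convolution of $f$ and $g$ (given by the same formula for both Hartley transforms $H_1$ and $H_2$, and written here $\underset{H}{*}$) is $$\big(f\underset{H}{*} g\big)(x):= \frac{1}{2\sqrt{2\pi}}\int_{\mathbb{R}} f(y)\,[g(x+y) + g(x-y) + g(-x+y) - g(-x-y)]\, dy,\quad x\in\mathbb{R}.$$ $L_p(\mathbb{R})$ denotes the usual Lebesgue space with $\|f\|_{L_p(\mathbb{R})}=\big(\int_{\mathbb{R}}|f(x)|^p dx\big)^{1/p}$. *)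

theory Defs
  imports "HOL-Analysis.Analysis"
begin

text \<open>
  The scalars range over the Banach fields over the reals, so that the definitions
  cover both real-valued and complex-valued functions.  Functions are Lebesgue
  measurable and are not identified when they agree almost everywhere.
\<close>

definition Lp_space ::
    "real \<Rightarrow> (real \<Rightarrow> 'a::{real_normed_field,banach,second_countable_topology}) set" where
  "Lp_space p =
     {f. f \<in> borel_measurable lebesgue \<and> integrable lebesgue (\<lambda>x. norm (f x) powr p)}"

definition Lp_norm ::
    "real \<Rightarrow> (real \<Rightarrow> 'a::{real_normed_field,banach,second_countable_topology}) \<Rightarrow> real" where
  "Lp_norm p f = (LINT x|lebesgue. norm (f x) powr p) powr (1 / p)"

definition hartley_integrand ::
    "(real \<Rightarrow> 'a::{real_normed_field,banach,second_countable_topology}) \<Rightarrow> (real \<Rightarrow> 'a)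
      \<Rightarrow> real \<Rightarrow> real \<Rightarrow> 'a" where
  "hartley_integrand f g x y = f y * (g (x + y) + g (x - y) + g (- x + y) - g (- x - y))"

text \<open>
  The Bochner integral of a non-integrable function is 0 by convention, so existence of
  the convolution at \<open>x\<close> is the separate condition
  \<open>integrable lebesgue (hartley_integrand f g x)\<close>.
\<close>

definition hartley_conv ::
    "(real \<Rightarrow> 'a::{real_normed_field,banach,second_countable_topology}) \<Rightarrow> (real \<Rightarrow> 'a)
      \<Rightarrow> real \<Rightarrow> 'a" where
  "hartley_conv f g x =
     (1 / (2 * sqrt (2 * pi))) *\<^sub>R (LINT y|lebesgue. hartley_integrand f g x y)"

end

theory Submission
  imports Defs
begin

text \<open>
  The Hartley convolution is an integral operator applied to \<open>f\<close>, with kernel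
  \<open>k x y = g (x + y) + g (x - y) + g (- x + y) - g (- x - y)\<close>, and the theorem is an instance of
  Young's inequality for integral operators (\<open>Young_inequality_kernel\<close>): if the \<open>L\<^sub>q\<close> norms of
  all the sections \<open>k x _\<close> and \<open>k _ y\<close> are at most \<open>B\<close>, then the operator maps \<open>L\<^sub>p\<close> to \<open>L\<^sub>r\<close> with
  norm at most \<open>B\<close>. Each section of the Hartley kernel is a combination with coefficients \<open>\<plusminus>1\<close>
  of four reflected translates of \<open>g\<close>, which gives \<open>B = 4 * \<parallel>g\<parallel>\<^sub>q\<close>
  (\<open>nn_integral_hartley_kernel_le\<close>); the kernel is symmetric, so one family of sections suffices.
  The normalising factor of the convolution then yields
  \<open>4 / (2 * sqrt (2 * pi)) = sqrt (2 / pi)\<close>.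

  Young's inequality for operators comes from the factorisation
  \<open>\<bar>f\<bar> \<bar>k\<bar> = (\<bar>f\<bar>\<^sup>p \<bar>k\<bar>\<^sup>q)\<^sup>a (\<bar>f\<bar>\<^sup>p)\<^sup>b (\<bar>k\<bar>\<^sup>q)\<^sup>c\<close> with \<open>a = 1/r\<close>, \<open>b = 1 - 1/q\<close>, \<open>c = 1 - 1/p\<close>. The
  relation between the exponents says both that \<open>a + b + c = 1\<close> and that the exponents on the two
  sides agree. Hoelder's inequality for three functions in the variable \<open>y\<close> bounds the operator by
  a constant times \<open>S(x)\<^sup>a\<close>, where \<open>S(x) = \<integral> \<bar>f(y)\<bar>\<^sup>p \<bar>k(x,y)\<bar>\<^sup>q dy\<close>, and by Tonelli's theorem \<open>S\<close> has
  finite integral.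

  Tonelli's theorem is applied to the product of two Borel measures, whereas \<open>f\<close> and \<open>g\<close> are only Lebesgue
  measurable and \<open>(x, y) \<mapsto> g (x - y)\<close> need not be measurable for the product of two completions.
  Both functions are therefore replaced by almost everywhere equal Borel functions. As affine maps
  of the line preserve null sets, this leaves the convolution unchanged at every point, not merely
  almost everywhere (\<open>hartley_integrand_cong_AE\<close>).
\<close>

section \<open>Borel representatives of functions measurable for a completion\<close>

text \<open>
  The preimage of each set of a countable base is measurable up to a null set. The union of these
  countably many null sets is again null, and making \<open>f\<close> constant on it repairs all the preimages
  at once.
\<close>
lemma completion_AE_eq_borel_measurable:
  fixes f :: "'a \<Rightarrow> 'b::second_countable_topology"
  assumes f: "f \<in> borel_measurable (completion M)"
  obtains f' where "f' \<in> borel_measurable M" "AE x in M. f x = f' x"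
proof -
  obtain B :: "'b set set" where B: "countable B" "topological_basis B"
    using ex_countable_basis by auto
  let ?F = "\<lambda>b. f -` b \<inter> space M"
  have F: "?F b \<in> sets (completion M)" if "b \<in> B" for b
    using measurable_sets[OF f, of b] topological_basis_open[OF B(2) that] by simp
  have "\<forall>b\<in>B. \<exists>N. N \<in> null_sets M \<and> null_part M (?F b) \<subseteq> N"
    using F null_part by blast
  then obtain N where N: "\<And>b. b \<in> B \<Longrightarrow> N b \<in> null_sets M"
      "\<And>b. b \<in> B \<Longrightarrow> null_part M (?F b) \<subseteq> N b"
    by metis
  define Z where "Z = (\<Union>b\<in>B. N b)"
  have Z: "Z \<in> null_sets M"
    unfolding Z_def using B(1) N(1) by (intro null_sets_UN') auto
  define f' where "f' = (\<lambda>x. if x \<in> Z then undefined else f x)"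
  have base: "f' -` b \<inter> space M \<in> sets M" if b: "b \<in> B" for b
  proof -
    have "?F b = main_part M (?F b) \<union> null_part M (?F b)"
      using main_part_null_part_Un[OF F[OF b]] by simp
    moreover have "null_part M (?F b) \<subseteq> Z"
      using N(2)[OF b] b by (auto simp: Z_def)
    ultimately have "?F b - Z = main_part M (?F b) - Z"
      by blast
    moreover have "f' -` b \<inter> space M = (?F b - Z) \<union> (if undefined \<in> b then Z else {})"
      using sets.sets_into_space[of Z M] Z by (auto simp: f'_def split: if_splits)
    ultimately show ?thesis
      using main_part_sets[OF F[OF b]] Z by auto
  qed
  have "f' \<in> borel_measurable M"
  proof (rule borel_measurableI)
    fix S :: "'b set" assume "open S"
    then obtain C where C: "C \<subseteq> B" "S = \<Union>C"
      using B(2) by (auto simp: topological_basis_def)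
    have "f' -` S \<inter> space M = (\<Union>b\<in>C. f' -` b \<inter> space M)"
      unfolding C(2) by auto
    also have "\<dots> \<in> sets M"
      using C(1) B(1) base by (intro sets.countable_UN') (auto intro: countable_subset)
    finally show "f' -` S \<inter> space M \<in> sets M" .
  qed
  moreover have "AE x in M. f x = f' x"
    using AE_not_in[OF Z] by eventually_elim (simp add: f'_def)
  ultimately show thesis by (rule that)
qed

section \<open>Hoelder's inequality for three functions\<close>

text \<open>
  The weighted inequality for two numbers, applied first to \<open>y\<close> and \<open>z\<close> with weights \<open>b / (b + c)\<close>
  and \<open>c / (b + c)\<close>, and then to \<open>x\<close> and the resulting geometric mean.
\<close>
lemma weighted_arith_geom_mean3:
  fixes x y z a b c :: real
  assumes "0 \<le> x" "0 \<le> y" "0 \<le> z" and abc: "0 < a" "0 < b" "0 < c" "a + b + c = 1"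
  shows "x powr a * y powr b * z powr c \<le> a * x + b * y + c * z"
proof (cases "x = 0 \<or> y = 0 \<or> z = 0")
  case True
  then show ?thesis using assms by auto
next
  case False
  then have pos: "0 < x" "0 < y" "0 < z" using assms by auto
  define s where "s = b + c"
  have s: "0 < s" "a + s = 1" using abc by (auto simp: s_def)
  define w where "w = y powr (b / s) * z powr (c / s)"
  have "w > 0" using pos by (simp add: w_def)
  have "w \<le> (b / s) * y + (c / s) * z"
    unfolding w_def using abc pos s
    by (intro Youngs_inequality_0) (auto simp: s_def simp flip: add_divide_distrib)
  then have w: "s * w \<le> b * y + c * z"
    using s by (simp add: field_simps)
  have "x powr a * y powr b * z powr c = x powr a * w powr s"
    unfolding w_def using pos s by (simp add: powr_mult powr_powr mult.assoc)
  also have "\<dots> \<le> a * x + s * w"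
    using abc s pos \<open>w > 0\<close> by (intro Youngs_inequality_0) auto
  finally show ?thesis using w by linarith
qed

text \<open>
  With \<open>F\<close>, \<open>G\<close> and \<open>H\<close> divided by the bounds on their integrals, this is the integrated weighted
  inequality of arithmetic and geometric means. A bound that is zero forces its function to vanish
  almost everywhere.
\<close>
lemma nn_integral_Holder3:
  fixes F G H :: "'a \<Rightarrow> real"
  assumes [measurable]: "F \<in> borel_measurable M" "G \<in> borel_measurable M" "H \<in> borel_measurable M"
    and nonneg: "\<And>x. 0 \<le> F x" "\<And>x. 0 \<le> G x" "\<And>x. 0 \<le> H x"
    and abc: "0 < a" "0 < b" "0 < c" "a + b + c = 1"
    and bounds: "0 \<le> \<alpha>" "0 \<le> \<beta>" "0 \<le> \<gamma>"
      "(\<integral>\<^sup>+x. F x \<partial>M) \<le> ennreal \<alpha>" "(\<integral>\<^sup>+x. G x \<partial>M) \<le> ennreal \<beta>" "(\<integral>\<^sup>+x. H x \<partial>M) \<le> ennreal \<gamma>"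
  shows "(\<integral>\<^sup>+x. ennreal (F x powr a * G x powr b * H x powr c) \<partial>M)
           \<le> ennreal (\<alpha> powr a * \<beta> powr b * \<gamma> powr c)"
proof (cases "\<alpha> = 0 \<or> \<beta> = 0 \<or> \<gamma> = 0")
  case True
  have vanish: "AE x in M. u x = 0"
    if "u \<in> borel_measurable M" "\<And>x. 0 \<le> u x" "(\<integral>\<^sup>+x. ennreal (u x) \<partial>M) \<le> ennreal 0" for u :: "'a \<Rightarrow> real"
  proof -
    have "AE x in M. ennreal (u x) = 0"
      using that by (subst nn_integral_0_iff_AE[symmetric]) auto
    then show ?thesis
      by eventually_elim (use that(2) in \<open>simp add: ennreal_eq_0_iff antisym\<close>)
  qed
  have "AE x in M. F x = 0 \<or> G x = 0 \<or> H x = 0"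
    using True
  proof (elim disjE)
    assume "\<alpha> = 0"
    then have "AE x in M. F x = 0" using vanish[of F] nonneg bounds by simp
    then show ?thesis by eventually_elim simp
  next
    assume "\<beta> = 0"
    then have "AE x in M. G x = 0" using vanish[of G] nonneg bounds by simp
    then show ?thesis by eventually_elim simp
  next
    assume "\<gamma> = 0"
    then have "AE x in M. H x = 0" using vanish[of H] nonneg bounds by simp
    then show ?thesis by eventually_elim simp
  qed
  then have "AE x in M. ennreal (F x powr a * G x powr b * H x powr c) = 0"
    by eventually_elim auto
  then have "(\<integral>\<^sup>+x. ennreal (F x powr a * G x powr b * H x powr c) \<partial>M) = 0"
    by (subst nn_integral_0_iff_AE) auto
  then show ?thesis by simp
next
  case False
  then have pos: "0 < \<alpha>" "0 < \<beta>" "0 < \<gamma>" using bounds by auto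
  define C where "C = \<alpha> powr a * \<beta> powr b * \<gamma> powr c"
  have "C > 0" using pos by (simp add: C_def)
  have pt: "F x powr a * G x powr b * H x powr c
      \<le> C * a / \<alpha> * F x + C * b / \<beta> * G x + C * c / \<gamma> * H x" for x
  proof -
    have "F x powr a * G x powr b * H x powr c
        = C * ((F x / \<alpha>) powr a * (G x / \<beta>) powr b * (H x / \<gamma>) powr c)"
      using pos nonneg by (simp add: C_def powr_divide)
    also have "\<dots> \<le> C * (a * (F x / \<alpha>) + b * (G x / \<beta>) + c * (H x / \<gamma>))"
      using \<open>C > 0\<close> pos nonneg abc by (intro mult_left_mono weighted_arith_geom_mean3) auto
    finally show ?thesis by (simp add: algebra_simps)
  qed
  have "(\<integral>\<^sup>+x. ennreal (F x powr a * G x powr b * H x powr c) \<partial>M)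
      \<le> (\<integral>\<^sup>+x. ennreal (C * a / \<alpha>) * ennreal (F x) + ennreal (C * b / \<beta>) * ennreal (G x)
            + ennreal (C * c / \<gamma>) * ennreal (H x) \<partial>M)"
    using pt nonneg pos abc \<open>C > 0\<close>
    by (intro nn_integral_mono) (simp flip: ennreal_mult ennreal_plus)
  also have "\<dots> = ennreal (C * a / \<alpha>) * (\<integral>\<^sup>+x. F x \<partial>M) + ennreal (C * b / \<beta>) * (\<integral>\<^sup>+x. G x \<partial>M)
            + ennreal (C * c / \<gamma>) * (\<integral>\<^sup>+x. H x \<partial>M)"
    by (simp add: nn_integral_add nn_integral_cmult)
  also have "\<dots> \<le> ennreal (C * a / \<alpha>) * ennreal \<alpha> + ennreal (C * b / \<beta>) * ennreal \<beta>
            + ennreal (C * c / \<gamma>) * ennreal \<gamma>"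
    using bounds by (intro add_mono mult_left_mono) auto
  also have "\<dots> = ennreal (C * (a + b + c))"
    using pos abc(1-3) \<open>C > 0\<close> by (simp add: distrib_left flip: ennreal_mult ennreal_plus)
  finally show ?thesis by (simp add: abc(4) C_def)
qed

section \<open>Young's inequality for integral operators\<close>

text \<open>
  Hoelder's inequality in \<open>y\<close> uses the bound on the sections \<open>k x _\<close> and gives a pointwise estimate
  by a multiple of \<open>S(x)\<^sup>1\<^sup>/\<^sup>r\<close>; the bound on the sections \<open>k _ y\<close> enters through Tonelli's theorem,
  in the integral of \<open>S\<close>. The norm bounds use nonnegative integrals, so that each of them includes
  the finiteness of the integral.
\<close>
theorem Young_inequality_kernel:
  fixes f :: "'b \<Rightarrow> 'c::{real_normed_algebra,banach,second_countable_topology}"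
    and k :: "'a \<Rightarrow> 'b \<Rightarrow> 'c"
  assumes "sigma_finite_measure M" "sigma_finite_measure N"
    and [measurable]: "f \<in> borel_measurable N" "case_prod k \<in> borel_measurable (M \<Otimes>\<^sub>M N)"
    and pqr: "1 < p" "1 < q" "1 < r" "1 / p + 1 / q = 1 + 1 / r"
    and AB: "0 \<le> A" "0 \<le> B"
    and f_le: "(\<integral>\<^sup>+y. norm (f y) powr p \<partial>N) \<le> ennreal (A powr p)"
    and k_le: "\<And>x. x \<in> space M \<Longrightarrow> (\<integral>\<^sup>+y. norm (k x y) powr q \<partial>N) \<le> ennreal (B powr q)"
    and k_le': "\<And>y. y \<in> space N \<Longrightarrow> (\<integral>\<^sup>+x. norm (k x y) powr q \<partial>M) \<le> ennreal (B powr q)"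
  shows "AE x in M. integrable N (\<lambda>y. f y * k x y)"
    and "(\<lambda>x. LINT y|N. f y * k x y) \<in> borel_measurable M"
    and "(\<integral>\<^sup>+x. norm (LINT y|N. f y * k x y) powr r \<partial>M) \<le> ennreal ((A * B) powr r)"
proof -
  interpret M: sigma_finite_measure M by fact
  interpret N: sigma_finite_measure N by fact
  interpret MN: pair_sigma_finite M N ..
  have k_measurable [measurable]: "k x \<in> borel_measurable N" if "x \<in> space M" for x
    using measurable_compose_Pair1[OF that, of "case_prod k" N borel] by simp
  show T_meas [measurable]: "(\<lambda>x. LINT y|N. f y * k x y) \<in> borel_measurable M"
    by measurable
  \<comment> \<open>The first Hoelder factor: its integral is finite by Tonelli, so it is finite almost everywhere.\<close>
  define S where "S = (\<lambda>x. \<integral>\<^sup>+y. ennreal (norm (f y) powr p * norm (k x y) powr q) \<partial>N)"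
  have S_meas [measurable]: "S \<in> borel_measurable M"
    unfolding S_def by measurable
  have "(\<integral>\<^sup>+x. S x \<partial>M) = (\<integral>\<^sup>+y. \<integral>\<^sup>+x. ennreal (norm (f y) powr p * norm (k x y) powr q) \<partial>M \<partial>N)"
    unfolding S_def by (rule MN.Fubini'[symmetric]) measurable
  also have "\<dots> = (\<integral>\<^sup>+y. ennreal (norm (f y) powr p) * (\<integral>\<^sup>+x. norm (k x y) powr q \<partial>M) \<partial>N)"
    by (intro nn_integral_cong) (simp add: ennreal_mult nn_integral_cmult)
  also have "\<dots> \<le> (\<integral>\<^sup>+y. ennreal (norm (f y) powr p) * ennreal (B powr q) \<partial>N)"
    by (intro nn_integral_mono mult_left_mono k_le') auto
  also have "\<dots> = (\<integral>\<^sup>+y. norm (f y) powr p \<partial>N) * ennreal (B powr q)"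
    by (rule nn_integral_multc) measurable
  also have "\<dots> \<le> ennreal (A powr p * B powr q)"
    using f_le by (simp add: ennreal_mult mult_right_mono)
  finally have S_le: "(\<integral>\<^sup>+x. S x \<partial>M) \<le> ennreal (A powr p * B powr q)" .
  have S_fin: "AE x in M. S x \<noteq> \<infinity>"
    using S_le by (intro nn_integral_PInf_AE) (auto simp: top_unique)

  \<comment> \<open>The remaining Hoelder exponents; \<open>1 / r + b = 1 / p\<close> and \<open>1 / r + c = 1 / q\<close>.\<close>
  define b c where "b = 1 - 1 / q" and "c = 1 - 1 / p"
  have bc: "0 < b" "0 < c" "1 / r + b + c = 1"
    using pqr by (auto simp: b_def c_def)
  have exps: "p / r + p * b = 1" "q / r + q * c = 1" "p * b * r = r - p" "q * c * r = r - q"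
  proof -
    have "1 / r + b = 1 / p" "1 / r + c = 1 / q" using pqr by (auto simp: b_def c_def)
    then have "p * (1 / r + b) = 1" "q * (1 / r + c) = 1" using pqr by auto
    then show *: "p / r + p * b = 1" "q / r + q * c = 1" by (auto simp: algebra_simps)
    then have "(p / r + p * b) * r = r" "(q / r + q * c) * r = r" by auto
    then show "p * b * r = r - p" "q * c * r = r - q" using pqr by (auto simp: algebra_simps)
  qed
  have norm_le: "(\<integral>\<^sup>+y. norm (f y * k x y) \<partial>N)
      \<le> ennreal (enn2real (S x) powr (1 / r) * A powr (p * b) * B powr (q * c))"
    if x: "x \<in> space M" and fin: "S x \<noteq> \<infinity>" for x
  proof -
    note [measurable] = k_measurable[OF x]
    have S_x: "(\<integral>\<^sup>+y. ennreal (norm (f y) powr p * norm (k x y) powr q) \<partial>N) \<le> ennreal (enn2real (S x))"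
      using fin by (simp add: S_def less_top)
    have split: "norm (f y * k x y) \<le> (norm (f y) powr p * norm (k x y) powr q) powr (1 / r)
        * (norm (f y) powr p) powr b * (norm (k x y) powr q) powr c" for y
    proof -
      have "(norm (f y) powr p * norm (k x y) powr q) powr (1 / r)
            * (norm (f y) powr p) powr b * (norm (k x y) powr q) powr c
          = norm (f y) powr (p / r + p * b) * norm (k x y) powr (q / r + q * c)"
        by (simp add: powr_mult powr_powr powr_add)
      also have "\<dots> = norm (f y) * norm (k x y)"
        by (simp add: exps)
      finally show ?thesis by (simp add: norm_mult_ineq)
    qed
    have "(\<integral>\<^sup>+y. norm (f y * k x y) \<partial>N)
       \<le> (\<integral>\<^sup>+y. ennreal ((norm (f y) powr p * norm (k x y) powr q) powr (1 / r)
        * (norm (f y) powr p) powr b * (norm (k x y) powr q) powr c) \<partial>N)"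
      by (intro nn_integral_mono ennreal_leI split)
    also have "\<dots> \<le> ennreal (enn2real (S x) powr (1 / r) * (A powr p) powr b * (B powr q) powr c)"
      using bc pqr(3) f_le k_le[OF x] S_x
      by (intro nn_integral_Holder3) auto
    finally show ?thesis by (simp add: powr_powr)
  qed
  show "AE x in M. integrable N (\<lambda>y. f y * k x y)"
    using S_fin AE_space
  proof eventually_elim
    case (elim x)
    note [measurable] = k_measurable[OF elim(2)]
    show ?case
      using norm_le[OF elim(2,1)]
      by (auto simp: integrable_iff_bounded intro: le_less_trans)
  qed
  have "AE x in M. ennreal (norm (LINT y|N. f y * k x y) powr r)
      \<le> S x * ennreal (A powr (r - p) * B powr (r - q))"
    using S_fin AE_space
  proof eventually_elim
    case (elim x)
    have "ennreal (norm (LINT y|N. f y * k x y)) \<le> (\<integral>\<^sup>+y. norm (f y * k x y) \<partial>N)"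
      by (cases "integrable N (\<lambda>y. f y * k x y)")
        (auto simp: integral_norm_bound_ennreal not_integrable_integral_eq)
    also note norm_le[OF elim(2,1)]
    finally have "norm (LINT y|N. f y * k x y)
        \<le> enn2real (S x) powr (1 / r) * A powr (p * b) * B powr (q * c)"
      by simp
    then have "norm (LINT y|N. f y * k x y) powr r
        \<le> (enn2real (S x) powr (1 / r) * A powr (p * b) * B powr (q * c)) powr r"
      using pqr by (intro powr_mono2) auto
    also have "\<dots> = enn2real (S x) * (A powr (r - p) * B powr (r - q))"
      using pqr by (simp add: powr_mult powr_powr exps)
    finally have "ennreal (norm (LINT y|N. f y * k x y) powr r)
        \<le> ennreal (enn2real (S x) * (A powr (r - p) * B powr (r - q)))"
      by (rule ennreal_leI)
    also have "\<dots> = ennreal (enn2real (S x)) * ennreal (A powr (r - p) * B powr (r - q))"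
      by (rule ennreal_mult) auto
    also have "ennreal (enn2real (S x)) = S x"
      using elim(1) by (simp add: less_top)
    finally show ?case .
  qed
  then have "(\<integral>\<^sup>+x. norm (LINT y|N. f y * k x y) powr r \<partial>M)
      \<le> (\<integral>\<^sup>+x. S x * ennreal (A powr (r - p) * B powr (r - q)) \<partial>M)"
    by (rule nn_integral_mono_AE)
  also have "\<dots> = (\<integral>\<^sup>+x. S x \<partial>M) * ennreal (A powr (r - p) * B powr (r - q))"
    by (rule nn_integral_multc) measurable
  also have "\<dots> \<le> ennreal (A powr p * B powr q) * ennreal (A powr (r - p) * B powr (r - q))"
    by (intro mult_right_mono S_le) auto
  also have "\<dots> = ennreal ((A powr p * A powr (r - p)) * (B powr q * B powr (r - q)))"
    by (simp add: mult_ac flip: ennreal_mult)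
  also have "\<dots> = ennreal ((A * B) powr r)"
    by (simp add: powr_mult flip: powr_add)
  finally show "(\<integral>\<^sup>+x. norm (LINT y|N. f y * k x y) powr r \<partial>M) \<le> ennreal ((A * B) powr r)" .
qed

section \<open>The Hartley kernel\<close>

text \<open>
  Midpoint convexity of \<open>t \<mapsto> t powr q\<close>. When one argument is \<open>0\<close>, it reduces to
  \<open>(1/2) powr q \<le> 1/2\<close>; otherwise the function is smooth near the segment and \<open>powr_convex\<close> applies.
\<close>
lemma powr_average_le:
  fixes a b q :: real
  assumes "1 \<le> q" "0 \<le> a" "0 \<le> b"
  shows "((a + b) / 2) powr q \<le> (a powr q + b powr q) / 2"
proof (cases "a = 0 \<or> b = 0")
  case True
  have half: "(c / 2) powr q \<le> c powr q / 2" if "0 \<le> c" for c :: real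
  proof -
    have "(1 / 2) powr q \<le> (1 / 2 :: real) powr 1"
      using assms(1) by (intro powr_mono') auto
    then have "c powr q * (1 / 2) powr q \<le> c powr q * (1 / 2)"
      by (intro mult_left_mono) auto
    then show ?thesis
      using that by (simp add: powr_mult[symmetric])
  qed
  show ?thesis using True half[of a] half[of b] assms by auto
next
  case False
  then have "0 < a" "0 < b" using assms by auto
  then show ?thesis
    using convex_onD[OF powr_convex[OF assms(1)], of "1/2" a b]
    by (simp add: add_divide_distrib)
qed

lemma powr_sum4_le:
  fixes a b c d q :: real
  assumes "1 \<le> q" "0 \<le> a" "0 \<le> b" "0 \<le> c" "0 \<le> d"
  shows "(a + b + c + d) powr q \<le> 4 powr q / 4 * (a powr q + b powr q + c powr q + d powr q)"
proof -
  have "((a + b + c + d) / 4) powr q = (((a + b) / 2 + (c + d) / 2) / 2) powr q"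
    by (rule arg_cong[where f = "\<lambda>u. u powr q"]) (simp add: field_simps)
  also have "\<dots> \<le> (((a + b) / 2) powr q + ((c + d) / 2) powr q) / 2"
    using assms by (intro powr_average_le) auto
  also have "\<dots> \<le> (a powr q + b powr q + c powr q + d powr q) / 4"
    using powr_average_le[of q a b] powr_average_le[of q c d] assms by simp
  finally have "4 powr q * ((a + b + c + d) / 4) powr q
      \<le> 4 powr q * ((a powr q + b powr q + c powr q + d powr q) / 4)"
    by (intro mult_left_mono) auto
  moreover have "4 powr q * ((a + b + c + d) / 4) powr q = (a + b + c + d) powr q"
    using assms by (simp add: powr_divide)
  ultimately show ?thesis by simp
qed

abbreviation hartley_kernel :: "(real \<Rightarrow> 'a::real_normed_vector) \<Rightarrow> real \<Rightarrow> real \<Rightarrow> 'a" where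
  "hartley_kernel g x y \<equiv> g (x + y) + g (x - y) + g (- x + y) - g (- x - y)"

lemma hartley_kernel_commute: "hartley_kernel g x y = hartley_kernel g y x"
proof -
  have eqs: "g (- x - y) = g (- y - x)" "g (x + y) = g (y + x)"
    "g (- x + y) = g (y - x)" "g (- y + x) = g (x - y)"
    by (intro arg_cong[where f = g], simp)+
  show ?thesis
    by (subst eqs(1), subst eqs(2), subst eqs(3), subst eqs(4)) (simp only: ac_simps)
qed

text \<open>
  Reflections and translations preserve Lebesgue measure, so each of the four summands has the
  same \<open>L\<^sub>q\<close> norm as \<open>g\<close>; convexity of \<open>t \<mapsto> t powr q\<close> replaces Minkowski's inequality.
\<close>
lemma nn_integral_hartley_kernel_le:
  fixes g :: "real \<Rightarrow> 'a::{real_normed_vector,second_countable_topology}"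
  assumes [measurable]: "g \<in> borel_measurable borel" and q: "1 \<le> q" and B: "0 \<le> B"
    and g_le: "(\<integral>\<^sup>+y. norm (g y) powr q \<partial>lborel) \<le> ennreal (B powr q)"
  shows "(\<integral>\<^sup>+y. norm (hartley_kernel g x y) powr q \<partial>lborel) \<le> ennreal ((4 * B) powr q)"
proof -
  let ?I = "\<integral>\<^sup>+y. norm (g y) powr q \<partial>lborel"
  have shift: "(\<integral>\<^sup>+y. norm (g (t + c * y)) powr q \<partial>lborel) = ?I" if "c = 1 \<or> c = - 1" for t c
    using that nn_integral_real_affine[of "\<lambda>y. ennreal (norm (g y) powr q)" c t] by auto
  have shifts: "(\<integral>\<^sup>+y. norm (g (x + y)) powr q \<partial>lborel) = ?I"
    "(\<integral>\<^sup>+y. norm (g (x - y)) powr q \<partial>lborel) = ?I"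
    "(\<integral>\<^sup>+y. norm (g (- x + y)) powr q \<partial>lborel) = ?I"
    "(\<integral>\<^sup>+y. norm (g (- x - y)) powr q \<partial>lborel) = ?I"
    using shift[of 1 x] shift[of "-1" x] shift[of 1 "-x"] shift[of "-1" "-x"] by simp_all
  have "norm (hartley_kernel g x y) powr q \<le>
      (norm (g (x + y)) + norm (g (x - y)) + norm (g (- x + y)) + norm (g (- x - y))) powr q" for y
    using q by (intro powr_mono2 norm_triangle_le_diff norm_triangle_le add_mono order_refl) auto
  then have pt: "norm (hartley_kernel g x y) powr q \<le> 4 powr q / 4 *
      (norm (g (x + y)) powr q + norm (g (x - y)) powr q
        + norm (g (- x + y)) powr q + norm (g (- x - y)) powr q)" for y
    by (rule order_trans) (use q in \<open>intro powr_sum4_le, auto\<close>)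
  have "(\<integral>\<^sup>+y. norm (hartley_kernel g x y) powr q \<partial>lborel)
      \<le> (\<integral>\<^sup>+y. ennreal (4 powr q / 4) *
      (ennreal (norm (g (x + y)) powr q) + ennreal (norm (g (x - y)) powr q)
        + ennreal (norm (g (- x + y)) powr q) + ennreal (norm (g (- x - y)) powr q)) \<partial>lborel)"
    using pt by (intro nn_integral_mono) (simp flip: ennreal_mult ennreal_plus)
  also have "\<dots> = ennreal (4 powr q / 4) * (?I + ?I + ?I + ?I)"
    by (simp add: nn_integral_cmult nn_integral_add shifts shifts(3)[simplified])
  also have "\<dots> \<le> ennreal (4 powr q / 4) *
      (ennreal (B powr q) + ennreal (B powr q) + ennreal (B powr q) + ennreal (B powr q))"
    by (intro mult_left_mono add_mono g_le) auto
  also have "\<dots> = ennreal ((4 * B) powr q)"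
    using B by (simp add: powr_mult flip: ennreal_mult ennreal_plus)
  finally show ?thesis .
qed

section \<open>Reduction to Borel functions\<close>

lemma Lp_space_borel_representative:
  fixes f :: "real \<Rightarrow> 'a::{real_normed_field,banach,second_countable_topology}"
  assumes f: "f \<in> Lp_space p" and p: "0 < p"
  obtains f' where "f' \<in> borel_measurable borel" "AE x in lborel. f x = f' x"
    "(\<integral>\<^sup>+x. norm (f' x) powr p \<partial>lborel) = ennreal (Lp_norm p f powr p)"
proof -
  have f_meas: "f \<in> borel_measurable lebesgue"
    and f_int: "integrable lebesgue (\<lambda>x. norm (f x) powr p)"
    using f by (auto simp: Lp_space_def)
  obtain f' where f': "f' \<in> borel_measurable lborel" "AE x in lborel. f x = f' x"
    using completion_AE_eq_borel_measurable[OF f_meas] by blast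
  have "(\<integral>\<^sup>+x. norm (f' x) powr p \<partial>lborel) = (\<integral>\<^sup>+x. norm (f x) powr p \<partial>lborel)"
    by (rule nn_integral_cong_AE) (use f'(2) in \<open>eventually_elim, simp\<close>)
  also have "\<dots> = (\<integral>\<^sup>+x. norm (f x) powr p \<partial>lebesgue)"
    by (simp add: nn_integral_completion)
  also have "\<dots> = ennreal (LINT x|lebesgue. norm (f x) powr p)"
    using f_int by (intro nn_integral_eq_integral) auto
  also have "\<dots> = ennreal (Lp_norm p f powr p)"
    using p by (simp add: Lp_norm_def powr_powr)
  finally show thesis using f' by (intro that) auto
qed

lemma Lp_spaceI_nn_integral:
  fixes h :: "real \<Rightarrow> 'a::{real_normed_field,banach,second_countable_topology}"
  assumes h: "h \<in> borel_measurable borel" and C: "0 \<le> C" and r: "0 < r"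
    and le: "(\<integral>\<^sup>+x. norm (h x) powr r \<partial>lborel) \<le> ennreal (C powr r)"
  shows "h \<in> Lp_space r" and "Lp_norm r h \<le> C"
proof -
  have h': "h \<in> borel_measurable lebesgue"
    using h by (simp add: measurable_completion)
  have le': "(\<integral>\<^sup>+x. norm (h x) powr r \<partial>lebesgue) \<le> ennreal (C powr r)"
    using le by (simp add: nn_integral_completion)
  have int: "integrable lebesgue (\<lambda>x. norm (h x) powr r)"
    using h' le' by (auto simp: integrable_iff_bounded intro: le_less_trans)
  then show "h \<in> Lp_space r"
    using h' by (simp add: Lp_space_def)
  have "(LINT x|lebesgue. norm (h x) powr r) \<le> C powr r"
    using le' by (simp add: nn_integral_eq_integral[OF int])
  then have "Lp_norm r h \<le> (C powr r) powr (1 / r)"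
    unfolding Lp_norm_def using r by (intro powr_mono2) auto
  then show "Lp_norm r h \<le> C"
    using C r by (simp add: powr_powr)
qed

lemma lebesgue_measurable_affine:
  fixes g :: "real \<Rightarrow> 'a::topological_space"
  assumes "g \<in> borel_measurable lebesgue" "c \<noteq> 0"
  shows "(\<lambda>y. g (t + c * y)) \<in> borel_measurable lebesgue"
  using measurable_compose[OF lebesgue_affine_measurable[where c="\<lambda>x::real. c" and t=t] assms(1)]
    assms(2) by simp

text \<open>
  The set where \<open>P\<close> fails may not be Borel, but it lies in a Borel null set, and \<open>AE_borel_affine\<close>
  applies to the complement of that set.
\<close>
lemma AE_lborel_affine:
  fixes P :: "real \<Rightarrow> bool"
  assumes "AE x in lborel. P x" "c \<noteq> 0"
  shows "AE y in lborel. P (t + c * y)"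
proof -
  obtain N where N: "N \<in> null_sets lborel" "\<And>x. x \<notin> N \<Longrightarrow> P x"
    using AE_E3[OF assms(1)] by auto
  have "AE y in lborel. t + c * y \<notin> N"
    using N(1) assms(2) AE_not_in[OF N(1)] by (intro AE_borel_affine) auto
  then show ?thesis
    by eventually_elim (use N(2) in auto)
qed

text \<open>
  For every fixed \<open>x\<close>, the exceptional set of \<open>g\<close> is moved to null sets by the four affine maps in
  the integrand, so the statement holds at each \<open>x\<close> without exception.
\<close>
lemma hartley_integrand_cong_AE:
  fixes f g f' g' :: "real \<Rightarrow> 'a::{real_normed_field,banach,second_countable_topology}"
  assumes f: "f \<in> borel_measurable lebesgue" and g: "g \<in> borel_measurable lebesgue"
    and f': "f' \<in> borel_measurable borel" "AE x in lborel. f x = f' x"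
    and g': "g' \<in> borel_measurable borel" "AE x in lborel. g x = g' x"
  shows "integrable lebesgue (hartley_integrand f g x) \<longleftrightarrow> integrable lborel (hartley_integrand f' g' x)"
    and "(LINT y|lebesgue. hartley_integrand f g x y) = (LINT y|lborel. hartley_integrand f' g' x y)"
proof -
  have g_aff: "(\<lambda>y. g (x + y)) \<in> borel_measurable lebesgue" "(\<lambda>y. g (x - y)) \<in> borel_measurable lebesgue"
    "(\<lambda>y. g (- x + y)) \<in> borel_measurable lebesgue" "(\<lambda>y. g (- x - y)) \<in> borel_measurable lebesgue"
    using lebesgue_measurable_affine[OF g, of 1 x] lebesgue_measurable_affine[OF g, of "-1" x]
      lebesgue_measurable_affine[OF g, of 1 "-x"] lebesgue_measurable_affine[OF g, of "-1" "-x"] by simp_all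
  have meas: "hartley_integrand f g x \<in> borel_measurable lebesgue"
    unfolding hartley_integrand_def
    by (intro borel_measurable_times borel_measurable_add borel_measurable_diff f g_aff)
  note [measurable] = f'(1) g'(1)
  have meas': "hartley_integrand f' g' x \<in> borel_measurable lborel"
    unfolding hartley_integrand_def by measurable
  have g_AE: "AE y in lborel. g (x + y) = g' (x + y)" "AE y in lborel. g (x - y) = g' (x - y)"
    "AE y in lborel. g (- x + y) = g' (- x + y)" "AE y in lborel. g (- x - y) = g' (- x - y)"
    using AE_lborel_affine[OF g'(2), of 1 x] AE_lborel_affine[OF g'(2), of "-1" x]
      AE_lborel_affine[OF g'(2), of 1 "-x"] AE_lborel_affine[OF g'(2), of "-1" "-x"] by simp_all
  have "AE y in lborel. hartley_integrand f g x y = hartley_integrand f' g' x y"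
    using f'(2) g_AE by eventually_elim (simp add: hartley_integrand_def)
  then have AE: "AE y in lebesgue. hartley_integrand f g x y = hartley_integrand f' g' x y"
    by (rule AE_completion)
  have meas'': "hartley_integrand f' g' x \<in> borel_measurable lebesgue"
    using meas' by (rule measurable_completion)
  show "integrable lebesgue (hartley_integrand f g x) \<longleftrightarrow> integrable lborel (hartley_integrand f' g' x)"
    using integrable_cong_AE[OF meas meas'' AE] integrable_completion[OF meas'] by simp
  show "(LINT y|lebesgue. hartley_integrand f g x y) = (LINT y|lborel. hartley_integrand f' g' x y)"
    using integral_cong_AE[OF meas meas'' AE] integral_completion[OF meas'] by simp
qed

section \<open>Young's inequality for the Hartley convolution\<close>

theorem corollary3p2:
  fixes p q r :: real
    and f g :: "real \<Rightarrow> 'a::{real_normed_field,banach,second_countable_topology}"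
  assumes "p > 1" and "q > 1" and "r > 1"
    and "1 / p + 1 / q = 1 + 1 / r"
    and "f \<in> Lp_space p" and "g \<in> Lp_space q"
  shows "(AE x in lebesgue. integrable lebesgue (hartley_integrand f g x)) \<and>
         hartley_conv f g \<in> Lp_space r \<and>
         Lp_norm r (hartley_conv f g) \<le> sqrt (2 / pi) * Lp_norm p f * Lp_norm q g"
proof -
  obtain f' where f' [measurable]: "f' \<in> borel_measurable borel" and f'_AE: "AE x in lborel. f x = f' x"
    and f'_norm: "(\<integral>\<^sup>+x. norm (f' x) powr p \<partial>lborel) = ennreal (Lp_norm p f powr p)"
    using Lp_space_borel_representative[OF assms(5)] assms(1) by auto
  obtain g' where g' [measurable]: "g' \<in> borel_measurable borel" and g'_AE: "AE x in lborel. g x = g' x"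
    and g'_norm: "(\<integral>\<^sup>+x. norm (g' x) powr q \<partial>lborel) = ennreal (Lp_norm q g powr q)"
    using Lp_space_borel_representative[OF assms(6)] assms(2) by auto
  have fg: "f \<in> borel_measurable lebesgue" "g \<in> borel_measurable lebesgue"
    using assms(5,6) by (auto simp: Lp_space_def)
  note cong = hartley_integrand_cong_AE[OF fg f' f'_AE g' g'_AE]
  have norms: "0 \<le> Lp_norm p f" "0 \<le> Lp_norm q g"
    by (simp_all add: Lp_norm_def)
  let ?T = "\<lambda>x. LINT y|lborel. f' y * hartley_kernel g' x y"
  have kernel_le: "(\<integral>\<^sup>+y. norm (hartley_kernel g' x y) powr q \<partial>lborel)
      \<le> ennreal ((4 * Lp_norm q g) powr q)" for x
    using assms(2) norms g'_norm by (intro nn_integral_hartley_kernel_le) auto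
  have kernel_le': "(\<integral>\<^sup>+x. norm (hartley_kernel g' x y) powr q \<partial>lborel)
      \<le> ennreal ((4 * Lp_norm q g) powr q)" for y
    using kernel_le[of y] by (simp only: hartley_kernel_commute[of g' _ y])
  have kernel_meas: "case_prod (hartley_kernel g') \<in> borel_measurable (lborel \<Otimes>\<^sub>M lborel)"
    by measurable
  note Young = Young_inequality_kernel[OF sigma_finite_lborel sigma_finite_lborel _ kernel_meas
      assms(1-4) norms(1) _ _ kernel_le kernel_le', of f']
  have Young':
    "AE x in lborel. integrable lborel (\<lambda>y. f' y * hartley_kernel g' x y)"
    "?T \<in> borel_measurable lborel"
    "(\<integral>\<^sup>+x. norm (?T x) powr r \<partial>lborel) \<le> ennreal ((Lp_norm p f * (4 * Lp_norm q g)) powr r)"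
    using Young f'_norm norms by auto
  have "AE x in lborel. integrable lebesgue (hartley_integrand f g x)"
    using Young'(1) unfolding cong(1) hartley_integrand_def .
  then have exists: "AE x in lebesgue. integrable lebesgue (hartley_integrand f g x)"
    by (rule AE_completion)
  define s where "s = 1 / (2 * sqrt (2 * pi))"
  have s: "0 < s" "s * 4 = sqrt (2 / pi)"
    by (simp_all add: s_def real_sqrt_mult real_sqrt_divide field_simps)
  have conv: "hartley_conv f g = (\<lambda>x. s *\<^sub>R ?T x)"
    unfolding hartley_conv_def[abs_def] cong(2)
    unfolding hartley_integrand_def[abs_def] s_def ..
  have "(\<integral>\<^sup>+x. norm (hartley_conv f g x) powr r \<partial>lborel)
      = (\<integral>\<^sup>+x. ennreal (s powr r) * ennreal (norm (?T x) powr r) \<partial>lborel)"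
    using s(1) by (simp add: conv powr_mult ennreal_mult)
  also have "\<dots> = ennreal (s powr r) * (\<integral>\<^sup>+x. norm (?T x) powr r \<partial>lborel)"
    using Young'(2) by (intro nn_integral_cmult) measurable
  also have "\<dots> \<le> ennreal (s powr r) * ennreal ((Lp_norm p f * (4 * Lp_norm q g)) powr r)"
    by (intro mult_left_mono Young'(3)) auto
  also have "\<dots> = ennreal ((s * (Lp_norm p f * (4 * Lp_norm q g))) powr r)"
    using s(1) norms by (simp add: powr_mult ennreal_mult)
  also have "s * (Lp_norm p f * (4 * Lp_norm q g)) = (s * 4) * Lp_norm p f * Lp_norm q g"
    by simp
  finally have le: "(\<integral>\<^sup>+x. norm (hartley_conv f g x) powr r \<partial>lborel)
      \<le> ennreal ((sqrt (2 / pi) * Lp_norm p f * Lp_norm q g) powr r)"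
    unfolding s(2) .
  have "hartley_conv f g \<in> borel_measurable borel"
    unfolding conv using Young'(2) by simp
  note Lp_spaceI_nn_integral[OF this _ _ le]
  then show ?thesis
    using exists assms(3) norms by simp
qed

end
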